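(* Let $\Delta:\mathbb{M}_2(\mathbb{C})\to \mathbb{M}_2(\mathbb{C})\otimes\mathbb{M}_2(\mathbb{C})$ be a unital Kadison-Schwarz operator for which the normalized trace $\tau$ is a Haar state. Then there are real numbers $b_{ml,k}$ ($m,l,k\in\{1,2,3\}$) such that, with $\mathbf b_{ml}=(b_{ml,1},b_{ml,2},b_{ml,3})$, $$\Delta(w_0\mathbf 1+\mathbf w\sigma)=w_0\,\mathbf 1\otimes \mathbf 1+\sum_{m,l=1}^3\langle \mathbf b_{ml},\overline{\mathbf w}\rangle\,\sigma_m\otimes\sigma_l \qquad (w_0\in\mathbb{C},\ \mathbf w\in\mathbb{C}^3),$$ and the coefficients satisfy, for all $\mathbf f\in S$ and $\mathbf w\in\mathbb{C}^3$, $$\|\mathbf w\|^2-i\sum_{m=1}^3 f_m\alpha_{\pi(m),\pi(m+1)}-\sum_{m=1}^3\|\mathbf x_m\|^2\ge 0,$$ $$\Big\|\mathbf q(\mathbf f,\mathbf w)-i\sum_{m=1}^3 f_m\gamma_{\pi(m),\pi(m+1)}-\sum_{m=1}^3[\mathbf x_m,\overline{\mathbf x}_m]\Big\|\le \|\mathbf w\|^2-i\sum_{k=1}^3 f_k\alpha_{\pi(k),\pi(k+1)}-\sum_{m=1}^3\|\mathbf x_m\|^2 ,$$ where $\mathbf x_m,\alpha_{ml},\gamma_{ml},\mathbf q(\mathbf f,\mathbf w),\pi$ are defined from $\{b_{ml,k}\}$, $\mathbf f$ and $\mathbf w$ as in the context.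
   Context: $\mathbf 1$ is the identity of $\mathbb{M}_2(\mathbb{C})$. A linear map $\Delta:\mathbb{M}_2(\mathbb{C})\to \mathbb{M}_2(\mathbb{C})\otimes\mathbb{M}_2(\mathbb{C})$ is unital if $\Delta\mathbf 1=\mathbf 1\otimes\mathbf 1$, and a Kadison-Schwarz operator if $\Delta(x^*x)\ge\Delta(x)^*\Delta(x)$ for all $x\in\mathbb{M}_2(\mathbb{C})$. A state $h$ is a Haar state for $\Delta$ if $(h\otimes id)\circ\Delta(x)=(id\otimes h)\circ\Delta(x)=h(x)\mathbf 1$ for all $x$. $\tau(x)=\frac12\mathrm{Tr}(x)$. Pauli matrices: $\sigma_1=\begin{pmatrix}0&1\\1&0\end{pmatrix}$, $\sigma_2=\begin{pmatrix}0&-i\\ i&0\end{pmatrix}$, $\sigma_3=\begin{pmatrix}1&0\\0&-1\end{pmatrix}$; $\mathbf w\sigma=w_1\sigma_1+w_2\sigma_2+w_3\sigma_3$ for $\mathbf w=(w_1,w_2,w_3)\in\mathbb{C}^3$. $\langle \mathbf u,\mathbf v\rangle=\sum_k u_k\overline{v_k}$ is the standard scalar product on $\mathbb{C}^3$, $\|\mathbf w\|=\sqrt{|w_1|^2+|w_2|^2+|w_3|^2}$, bars denote componentwise complex conjugation, and $[\cdot,\cdot]$ is the (complex bilinear) vector cross product on $\mathbb{C}^3$. $S$ is the closed Euclidean unit ball of $\mathbb{R}^3$. Given $\mathbf w\in\mathbb{C}^3$ and $\mathbf f=(f_1,f_2,f_3)\in S$, put $\mathbf x_m=(\langle\mathbf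 b_{m1},\mathbf w\rangle,\langle\mathbf b_{m2},\mathbf w\rangle,\langle\mathbf b_{m3},\mathbf w\rangle)$; $\alpha_{ml}=\langle\mathbf x_m,\mathbf x_l\rangle-\langle\mathbf x_l,\mathbf x_m\rangle$ (purely imaginary, so $i\alpha_{ml}$ is real); $\gamma_{ml}=[\mathbf x_m,\overline{\mathbf x_l}]+[\overline{\mathbf x_m},\mathbf x_l]$; $\beta(\mathbf f)_{ij}=\sum_{k=1}^3 b_{ki,j}f_k$, $\beta(\mathbf f)_m=(\beta(\mathbf f)_{m1},\beta(\mathbf f)_{m2},\beta(\mathbf f)_{m3})$; $\mathbf q(\mathbf f,\mathbf w)=(\langle\beta(\mathbf f)_1,[\mathbf w,\overline{\mathbf w}]\rangle,\langle\beta(\mathbf f)_2,[\mathbf w,\overline{\mathbf w}]\rangle,\langle\beta(\mathbf f)_3,[\mathbf w,\overline{\mathbf w}]\rangle)$. The map $\pi:\{1,2,3,4\}\to\{1,2,3\}$ is $\pi(1)=2,\ \pi(2)=3,\ \pi(3)=1,\ \pi(4)=\pi(1)=2$. *)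

theory Defs
  imports "HOL-Analysis.Analysis" "HOL-Library.Complex_Order"
begin

text \<open>
  The order on \<^typ>\<open>complex\<close> is the one of \<^theory>\<open>HOL-Library.Complex_Order\<close>: \<open>x \<le> y\<close> means
  \<open>Im x = Im y\<close> and \<open>Re x \<le> Re y\<close>, so \<open>0 \<le> z\<close> says that \<open>z\<close> is real and nonnegative.
  \<open>M\<^sub>2(C) \<otimes> M\<^sub>2(C)\<close> is the algebra of matrices whose rows and columns are indexed by
  pairs; \<open>kron\<close> is the tensor product of elements.
\<close>

type_synonym cmat2 = "complex ^ 2 ^ 2"
type_synonym cmat22 = "complex ^ (2 \<times> 2) ^ (2 \<times> 2)"

subsection \<open>Matrices, tensor products, states\<close>

definition mscale :: "complex \<Rightarrow> complex ^ 'n ^ 'm \<Rightarrow> complex ^ 'n ^ 'm" where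
  "mscale c A = (\<chi> i j. c * A $ i $ j)"

definition adjoint_mat :: "complex ^ 'n ^ 'm \<Rightarrow> complex ^ 'm ^ 'n" where
  "adjoint_mat A = (\<chi> i j. cnj (A $ j $ i))"

text \<open>The scalar product is linear in the first argument and conjugate-linear in the second.\<close>

definition cinner :: "complex ^ 'n \<Rightarrow> complex ^ 'n \<Rightarrow> complex" where
  "cinner u v = (\<Sum>k\<in>UNIV. u $ k * cnj (v $ k))"

definition psd :: "complex ^ 'n ^ 'n \<Rightarrow> bool" where
  "psd A \<longleftrightarrow> (\<forall>v. 0 \<le> cinner (A *v v) v)"

definition loewner_le :: "complex ^ 'n ^ 'n \<Rightarrow> complex ^ 'n ^ 'n \<Rightarrow> bool" where
  "loewner_le A B \<longleftrightarrow> psd (B - A)"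

definition kron :: "complex ^ 'a ^ 'b \<Rightarrow> complex ^ 'c ^ 'd \<Rightarrow> complex ^ ('a \<times> 'c) ^ ('b \<times> 'd)" where
  "kron A B = (\<chi> p q. A $ fst p $ fst q * B $ snd p $ snd q)"

definition is_state :: "(complex ^ 'n ^ 'n \<Rightarrow> complex) \<Rightarrow> bool" where
  "is_state h \<longleftrightarrow> Vector_Spaces.linear mscale (*) h \<and>
     (\<forall>x :: complex ^ 'n ^ 'n. 0 \<le> h (adjoint_mat x ** x)) \<and> h (mat 1) = 1"

text \<open>The maps \<open>h \<otimes> id\<close> and \<open>id \<otimes> h\<close> for a functional \<open>h\<close>; for linear \<open>h\<close> they are
  determined by their values on elementary tensors, see \<open>slice_left_kron\<close> and
  \<open>slice_right_kron\<close> below.\<close>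

definition slice_left :: "(cmat2 \<Rightarrow> complex) \<Rightarrow> cmat22 \<Rightarrow> cmat2" where
  "slice_left h X = (\<chi> j l. h (\<chi> i k. X $ (i, j) $ (k, l)))"

definition slice_right :: "(cmat2 \<Rightarrow> complex) \<Rightarrow> cmat22 \<Rightarrow> cmat2" where
  "slice_right h X = (\<chi> i k. h (\<chi> j l. X $ (i, j) $ (k, l)))"

definition clinear_map :: "(cmat2 \<Rightarrow> cmat22) \<Rightarrow> bool" where
  "clinear_map D \<longleftrightarrow> Vector_Spaces.linear mscale mscale D"

definition unital_map :: "(cmat2 \<Rightarrow> cmat22) \<Rightarrow> bool" where
  "unital_map D \<longleftrightarrow> D (mat 1) = kron (mat 1) (mat 1)"

definition kadison_schwarz :: "(cmat2 \<Rightarrow> cmat22) \<Rightarrow> bool" where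
  "kadison_schwarz D \<longleftrightarrow>
     (\<forall>x. loewner_le (adjoint_mat (D x) ** D x) (D (adjoint_mat x ** x)))"

definition haar_state :: "(cmat2 \<Rightarrow> complex) \<Rightarrow> (cmat2 \<Rightarrow> cmat22) \<Rightarrow> bool" where
  "haar_state h D \<longleftrightarrow> is_state h \<and>
     (\<forall>x. slice_left h (D x) = mscale (h x) (mat 1) \<and>
          slice_right h (D x) = mscale (h x) (mat 1))"

definition ntrace :: "cmat2 \<Rightarrow> complex" where
  "ntrace x = (1/2) * trace x"

lemma vector_space_mscale: "vector_space (mscale :: complex \<Rightarrow> complex ^ 'n ^ 'm \<Rightarrow> _)"
  by unfold_locales (auto simp: mscale_def vec_eq_iff algebra_simps)

lemma kron_one: "kron (mat 1) (mat 1) = mat 1"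
  by (auto simp: kron_def mat_def vec_eq_iff)

lemma kron_mult: "kron A B ** kron C D = kron (A ** C) (B ** D)"
proof -
  have "(\<Sum>k\<in>UNIV. A $ a $ fst k * B $ b $ snd k * (C $ fst k $ c * D $ snd k $ d)) =
        (\<Sum>k\<in>UNIV. A $ a $ k * C $ k $ c) * (\<Sum>k\<in>UNIV. B $ b $ k * D $ k $ d)" for a b c d
    by (simp add: sum_product sum.cartesian_product UNIV_Times_UNIV[symmetric] case_prod_unfold
          mult_ac del: UNIV_Times_UNIV)
  then show ?thesis
    by (simp add: kron_def matrix_matrix_mult_def vec_eq_iff)
qed

lemma adjoint_kron: "adjoint_mat (kron A B) = kron (adjoint_mat A) (adjoint_mat B)"
  by (simp add: kron_def adjoint_mat_def vec_eq_iff)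

lemma slice_left_kron:
  assumes "Vector_Spaces.linear mscale (*) h"
  shows "slice_left h (kron A B) = mscale (h A) B"
proof -
  interpret Vector_Spaces.linear mscale "(*)" h by fact
  have "(\<chi> i k. A $ i $ k * B $ j $ l) = mscale (B $ j $ l) A" for j l
    by (simp add: mscale_def vec_eq_iff mult.commute)
  then show ?thesis
    by (simp add: slice_left_def kron_def scale vec_eq_iff) (simp add: mscale_def mult.commute)
qed

lemma slice_right_kron:
  assumes "Vector_Spaces.linear mscale (*) h"
  shows "slice_right h (kron A B) = mscale (h B) A"
proof -
  interpret Vector_Spaces.linear mscale "(*)" h by fact
  have "(\<chi> j l. A $ i $ k * B $ j $ l) = mscale (A $ i $ k) B" for i k
    by (simp add: mscale_def vec_eq_iff)
  then show ?thesis
    by (simp add: slice_right_def kron_def scale vec_eq_iff) (simp add: mscale_def mult.commute)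
qed

subsection \<open>Pauli matrices and vectors in complex 3-space\<close>

definition pauli :: "3 \<Rightarrow> cmat2" where
  "pauli k =
     (if k = 1 then vector [vector [0, 1], vector [1, 0]]
      else if k = 2 then vector [vector [0, - \<i>], vector [\<i>, 0]]
      else vector [vector [1, 0], vector [0, -1]])"

definition pauli_vec :: "complex ^ 3 \<Rightarrow> cmat2" where
  "pauli_vec w = (\<Sum>k\<in>UNIV. mscale (w $ k) (pauli k))"

definition cnj_vec :: "complex ^ 'n \<Rightarrow> complex ^ 'n" where
  "cnj_vec w = (\<chi> k. cnj (w $ k))"

definition cvec :: "real ^ 'n \<Rightarrow> complex ^ 'n" where
  "cvec u = (\<chi> k. complex_of_real (u $ k))"

definition ccross :: "complex ^ 3 \<Rightarrow> complex ^ 3 \<Rightarrow> complex ^ 3" where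
  "ccross u v = vector
     [u $ 2 * v $ 3 - u $ 3 * v $ 2,
      u $ 3 * v $ 1 - u $ 1 * v $ 3,
      u $ 1 * v $ 2 - u $ 2 * v $ 1]"

subsection \<open>Quantities built from the coefficients\<close>

text \<open>The coefficient \<open>b\<^bsub>ml,k\<^esub>\<close> is \<open>b $ m $ l $ k\<close>, and \<open>b $ m $ l\<close> is the vector
  \<open>b\<^bsub>ml\<^esub>\<close>.\<close>

definition x_vec :: "real ^ 3 ^ 3 ^ 3 \<Rightarrow> complex ^ 3 \<Rightarrow> 3 \<Rightarrow> complex ^ 3" where
  "x_vec b w m = (\<chi> l. cinner (cvec (b $ m $ l)) w)"

definition alpha :: "real ^ 3 ^ 3 ^ 3 \<Rightarrow> complex ^ 3 \<Rightarrow> 3 \<Rightarrow> 3 \<Rightarrow> complex" where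
  "alpha b w m l = cinner (x_vec b w m) (x_vec b w l) - cinner (x_vec b w l) (x_vec b w m)"

definition gamma_vec :: "real ^ 3 ^ 3 ^ 3 \<Rightarrow> complex ^ 3 \<Rightarrow> 3 \<Rightarrow> 3 \<Rightarrow> complex ^ 3" where
  "gamma_vec b w m l =
     ccross (x_vec b w m) (cnj_vec (x_vec b w l)) + ccross (cnj_vec (x_vec b w m)) (x_vec b w l)"

definition beta :: "real ^ 3 ^ 3 ^ 3 \<Rightarrow> real ^ 3 \<Rightarrow> real ^ 3 ^ 3" where
  "beta b f = (\<chi> i j. \<Sum>k\<in>UNIV. b $ k $ i $ j * f $ k)"

definition q_vec :: "real ^ 3 ^ 3 ^ 3 \<Rightarrow> real ^ 3 \<Rightarrow> complex ^ 3 \<Rightarrow> complex ^ 3" where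
  "q_vec b f w = (\<chi> m. cinner (cvec (beta b f $ m)) (ccross w (cnj_vec w)))"

text \<open>The map \<open>\<pi> : {1,2,3,4} \<rightarrow> {1,2,3}\<close>. Its arguments are natural numbers, since in the
  type \<^typ>\<open>3\<close> the numerals \<open>4\<close> and \<open>1\<close> coincide; a natural number \<open>m\<close> in \<open>{1..3}\<close> is
  turned into a vector index by \<^const>\<open>of_nat\<close>.\<close>

definition pi_idx :: "nat \<Rightarrow> 3" where
  "pi_idx m = (if m = 1 then 2 else if m = 2 then 3 else if m = 3 then 1 else 2)"

end

theory Submission
  imports Defs
begin

text \<open>
  A self-adjoint unitary \<open>A\<close> satisfies \<open>(1 + A)\<^sup>2 = 2 (1 + A)\<close>, so positivity of \<open>\<Delta>\<close> on squares
  makes every \<open>\<Delta>(\<sigma>\<^sub>k)\<close> self-adjoint; since both partial traces vanish, \<open>\<Delta>(\<sigma>\<^sub>k)\<close> is then a real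
  combination of the \<open>\<sigma>\<^sub>m \<otimes> \<sigma>\<^sub>l\<close>.  For \<open>x = \<^bold>w\<sigma>\<close> the positive matrix \<open>\<Delta>(x\<^sup>*x) - \<Delta>(x)\<^sup>*\<Delta>(x)\<close> has
  the form \<open>1 \<otimes> Q\<^sub>0 + \<Sum>\<^sub>p \<sigma>\<^sub>p \<otimes> Q\<^sub>p\<close>.  Evaluating the first tensor factor at the state with Bloch
  vector \<open>\<^bold>f\<close> shows that \<open>Q\<^sub>0 + \<Sum>\<^sub>p f\<^sub>p Q\<^sub>p\<close> is positive.  It equals \<open>s 1 + \<^bold>v\<sigma>\<close> with \<open>s\<close> the right-hand
  side of the claimed inequality and \<open>\<^bold>v\<close> the vector on its left, multiplied by \<open>i\<close>, and
  positivity of \<open>s 1 + \<^bold>v\<sigma>\<close> forces \<open>\<parallel>\<^bold>v\<parallel> \<le> s\<close>.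
\<close>

section \<open>Sesquilinear form and positive semidefinite matrices\<close>

lemma cinner_add_left: "cinner (u + u') v = cinner u v + cinner u' v"
  by (simp add: cinner_def algebra_simps sum.distrib)

lemma cinner_add_right: "cinner u (v + v') = cinner u v + cinner u v'"
  by (simp add: cinner_def algebra_simps sum.distrib)

lemma cinner_scale_left: "cinner (c *s u) v = c * cinner u v"
  by (simp add: cinner_def algebra_simps sum_distrib_left)

lemma cinner_scale_right: "cinner u (c *s v) = cnj c * cinner u v"
  by (simp add: cinner_def algebra_simps sum_distrib_left)

lemma cinner_adjoint: "cinner (adjoint_mat A *v u) v = cinner u (A *v v)"
proof -
  have "cinner (adjoint_mat A *v u) v = (\<Sum>i\<in>UNIV. \<Sum>j\<in>UNIV. cnj (A $ j $ i) * u $ j * cnj (v $ i))"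
    by (simp add: cinner_def adjoint_mat_def matrix_vector_mult_def sum_distrib_right)
  also have "\<dots> = (\<Sum>j\<in>UNIV. \<Sum>i\<in>UNIV. cnj (A $ j $ i) * u $ j * cnj (v $ i))"
    by (rule sum.swap)
  also have "\<dots> = cinner u (A *v v)"
    by (simp add: cinner_def matrix_vector_mult_def sum_distrib_left mult_ac)
  finally show ?thesis .
qed

lemma cinner_self: "cinner v v = complex_of_real ((norm v)\<^sup>2)"
  by (simp add: cinner_def norm_vec_def L2_set_def sum_nonneg flip: complex_norm_square)

lemma psd_adjoint_mult: "psd (adjoint_mat A ** A)"
  by (simp add: psd_def cinner_adjoint cinner_self less_eq_complex_def flip: matrix_vector_mul_assoc)

lemma psd_add: "psd A \<Longrightarrow> psd B \<Longrightarrow> psd (A + B)"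
  by (simp add: psd_def matrix_vector_mult_add_rdistrib cinner_add_left)

text \<open>Polarization: since the quadratic form is real, expanding it at
  \<open>u + c *s v\<close> makes \<open>cnj c * B u v + c * B v u\<close> real. The choices
  \<open>c = 1\<close> and \<open>c = \<i>\<close> compare the imaginary and the real parts of
  \<open>B u v\<close> and \<open>B v u\<close>.\<close>

lemma psd_hermitian:
  assumes "psd A"
  shows "adjoint_mat A = A"
proof -
  define B where "B u v = cinner (A *v u) v" for u v
  have B_axis: "B (axis j 1) (axis i 1) = A $ i $ j" for i j
    by (simp add: B_def cinner_def matrix_vector_mult_def axis_def if_distrib if_distribR cong: if_cong)
  have Im0: "Im (B v v) = 0" for v
    using assms by (auto simp: B_def psd_def less_eq_complex_def)
  have pol: "Im (cnj c * B u v + c * B v u) = 0" for c u v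
  proof -
    have "B (u + c *s v) (u + c *s v) = B u u + cnj c * c * B v v + (cnj c * B u v + c * B v u)"
      by (simp add: B_def matrix_vector_right_distrib vector_scalar_commute cinner_add_left
          cinner_add_right cinner_scale_left cinner_scale_right algebra_simps)
    moreover have "Im (cnj c * c * B v v) = 0"
      using Im0[of v] by (simp add: algebra_simps)
    ultimately show ?thesis
      using Im0[of "u + c *s v"] Im0[of u] by (metis add.right_neutral add_0 plus_complex.simps(2))
  qed
  have "cnj (B u v) = B v u" for u v
    using pol[of 1 u v] pol[of \<i> u v] by (simp add: complex_eq_iff)
  then have "cnj (A $ j $ i) = A $ i $ j" for i j
    by (metis B_axis)
  then show ?thesis
    by (simp add: adjoint_mat_def vec_eq_iff)
qed

section \<open>Pauli matrices and their tensor products\<close>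

lemma pauli_entries [simp]:
  "pauli 1 $ 1 $ 1 = 0" "pauli 1 $ 1 $ 2 = 1" "pauli 1 $ 2 $ 1 = 1" "pauli 1 $ 2 $ 2 = 0"
  "pauli 2 $ 1 $ 1 = 0" "pauli 2 $ 1 $ 2 = -\<i>" "pauli 2 $ 2 $ 1 = \<i>" "pauli 2 $ 2 $ 2 = 0"
  "pauli 3 $ 1 $ 1 = 1" "pauli 3 $ 1 $ 2 = 0" "pauli 3 $ 2 $ 1 = 0" "pauli 3 $ 2 $ 2 = -1"
  by (simp_all add: pauli_def)

lemma pauli_hermitian: "adjoint_mat (pauli k) = pauli k"
  using exhaust_3[of k] by (auto simp: adjoint_mat_def vec_eq_iff forall_2)

lemma trace_pauli: "trace (pauli k) = 0"
  using exhaust_3[of k] by (auto simp: trace_def sum_2)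

lemma pauli_mult:
  "pauli k ** pauli k = mat 1"
  "pauli 1 ** pauli 2 = mscale \<i> (pauli 3)" "pauli 2 ** pauli 1 = mscale (-\<i>) (pauli 3)"
  "pauli 2 ** pauli 3 = mscale \<i> (pauli 1)" "pauli 3 ** pauli 2 = mscale (-\<i>) (pauli 1)"
  "pauli 3 ** pauli 1 = mscale \<i> (pauli 2)" "pauli 1 ** pauli 3 = mscale (-\<i>) (pauli 2)"
  using exhaust_3[of k]
  by (auto simp: matrix_matrix_mult_def vec_eq_iff forall_2 sum_2 mscale_def mat_def)

lemma pauli_vec_mult:
  "pauli_vec u ** pauli_vec v =
     mscale (\<Sum>k\<in>UNIV. u $ k * v $ k) (mat 1) + pauli_vec (\<i> *s ccross u v)"
  by (auto simp: matrix_matrix_mult_def vec_eq_iff forall_2 sum_2 sum_3 mscale_def mat_def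
      pauli_vec_def ccross_def algebra_simps)

lemma adjoint_pauli_vec: "adjoint_mat (pauli_vec w) = pauli_vec (cnj_vec w)"
  by (auto simp: adjoint_mat_def vec_eq_iff forall_2 sum_3 mscale_def pauli_vec_def cnj_vec_def)

lemma matrix_add_rdistrib: "(A + B) ** C = A ** C + B ** (C :: 'a::semiring_1 ^ _ ^ _)"
  by (simp add: matrix_matrix_mult_def vec_eq_iff distrib_right sum.distrib)

lemma adjoint_pauli_vec_mult:
  "adjoint_mat (pauli_vec w) ** pauli_vec w =
     mscale (complex_of_real ((norm w)\<^sup>2)) (mat 1) + pauli_vec (\<i> *s ccross (cnj_vec w) w)"
  by (auto simp: adjoint_pauli_vec pauli_vec_mult cnj_vec_def norm_vec_def L2_set_def sum_nonneg
      mult.commute simp flip: complex_norm_square)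

text \<open>Equal indices give \<open>pauli m ** pauli m = mat 1\<close>. Of two distinct indices
  both orders occur with opposite signs, so the second factors, which need not commute, combine to
  differences.\<close>

lemma pauli_kron_sum_mult:
  "(\<Sum>m\<in>UNIV. kron (pauli m) (A m)) ** (\<Sum>n\<in>UNIV. kron (pauli n) (B n)) =
     kron (mat 1) (\<Sum>m\<in>UNIV. A m ** B m) +
     (kron (pauli 1) (mscale \<i> (A 2 ** B 3 - A 3 ** B 2)) +
      kron (pauli 2) (mscale \<i> (A 3 ** B 1 - A 1 ** B 3)) +
      kron (pauli 3) (mscale \<i> (A 1 ** B 2 - A 2 ** B 1)))"
  by (simp add: sum_3 matrix_add_ldistrib matrix_add_rdistrib kron_mult pauli_mult)
     (simp add: kron_def vec_eq_iff mscale_def algebra_simps)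

text \<open>Vanishing slices remove every component with an identity in one of the factors, and
  self-adjointness makes the nine remaining coefficients real. Five entries determine the matrix:
  \<open>p\<close>, which is real, and \<open>q\<close>, \<open>r\<close>, \<open>s\<close>,
  \<open>t\<close>.\<close>

lemma hermitian_pauli_expansion:
  fixes X :: cmat22
  assumes "adjoint_mat X = X" "slice_left ntrace X = 0" "slice_right ntrace X = 0"
  obtains c :: "real ^ 3 ^ 3"
  where "X = (\<Sum>m\<in>UNIV. \<Sum>l\<in>UNIV. mscale (complex_of_real (c $ m $ l)) (kron (pauli m) (pauli l)))"
proof
  have herm: "X $ p $ q = cnj (X $ q $ p)" for p q
    using arg_cong[OF assms(1), of "\<lambda>Y. Y $ p $ q"] by (simp add: adjoint_mat_def)
  have L: "X $ (2, j) $ (2, l) = - X $ (1, j) $ (1, l)" for j l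
    using assms(2) by (auto simp: slice_left_def ntrace_def trace_def sum_2 vec_eq_iff
        add_eq_0_iff)
  have R: "X $ (i, 2) $ (k, 2) = - X $ (i, 1) $ (k, 1)" for i k
    using assms(3) by (auto simp: slice_right_def ntrace_def trace_def sum_2 vec_eq_iff
        add_eq_0_iff)
  define p q r s t where "p = X $ (1, 1) $ (1, 1)" and "q = X $ (1, 1) $ (1, 2)"
    and "r = X $ (1, 1) $ (2, 1)" and "s = X $ (1, 1) $ (2, 2)" and "t = X $ (1, 2) $ (2, 1)"
  note pqrst = p_def[symmetric] q_def[symmetric] r_def[symmetric] s_def[symmetric] t_def[symmetric]
  have "Im p = 0"
    using herm[of "(1, 1)" "(1, 1)"] by (simp add: p_def complex_eq_iff)
  moreover have "X $ (1, 2) $ (1, 1) = cnj q" "X $ (2, 1) $ (1, 1) = cnj r"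
    "X $ (2, 2) $ (1, 1) = cnj s" "X $ (2, 1) $ (1, 2) = cnj t"
    unfolding q_def r_def s_def t_def by (rule herm)+
  \<comment> \<open>The witness is
    \<open>c $ m $ l = trace (X ** kron (pauli m) (pauli l)) / 4\<close>, written in these five
    entries.\<close>
  ultimately show "X = (\<Sum>m\<in>UNIV. \<Sum>l\<in>UNIV. mscale (complex_of_real (vector
      [vector [(Re s + Re t) / 2, (Im t - Im s) / 2, Re r],
       vector [- (Im s + Im t) / 2, (Re t - Re s) / 2, - Im r],
       vector [Re q, - Im q, Re p]] $ m $ l)) (kron (pauli m) (pauli l)))"
    by (simp add: vec_eq_iff split_paired_all forall_2 sum_3 mscale_def kron_def complex_eq_iff L R pqrst)
      argo
qed

section \<open>Positivity tested on product vectors\<close>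

lemma cinner_kron:
  "cinner (kron A B *v (\<chi> p. u $ fst p * v $ snd p)) (\<chi> p. u' $ fst p * v' $ snd p) =
     cinner (A *v u) u' * cinner (B *v v) v'"
proof -
  have "kron A B *v (\<chi> p. u $ fst p * v $ snd p) = (\<chi> p. (A *v u) $ fst p * (B *v v) $ snd p)"
    by (simp add: kron_def matrix_vector_mult_def vec_eq_iff sum_product sum.cartesian_product
        UNIV_Times_UNIV[symmetric] case_prod_unfold mult_ac del: UNIV_Times_UNIV)
  then show ?thesis
    by (simp add: cinner_def sum_product sum.cartesian_product
        UNIV_Times_UNIV[symmetric] case_prod_unfold mult_ac del: UNIV_Times_UNIV)
qed

lemma cinner_sum_left: "cinner (\<Sum>i\<in>I. u i) v = (\<Sum>i\<in>I. cinner (u i) v)"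
  by (induction I rule: infinite_finite_induct) (auto simp: cinner_add_left, auto simp: cinner_def)

lemma sum_matrix_vector_mult: "(\<Sum>i\<in>I. A i) *v v = (\<Sum>i\<in>I. A i *v v)"
  by (induction I rule: infinite_finite_induct) (auto simp: matrix_vector_mult_add_rdistrib)

lemma mscale_matrix_vector_mult: "mscale c A *v v = c *s (A *v v)"
  by (simp add: mscale_def matrix_vector_mult_def vec_eq_iff sum_distrib_left mult_ac)

text \<open>The vectors are the columns of \<open>R = a 1 + \<^bold>g\<sigma>\<close> with \<open>R\<^sup>2 = 1 + \<^bold>f\<sigma>\<close>, that is,
  \<open>a\<^sup>2 + \<parallel>\<^bold>g\<parallel>\<^sup>2 = 1\<close> and \<open>2 a \<^bold>g = \<^bold>f\<close>.\<close>

lemma qubit_state_decomposition: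
  fixes f :: "real ^ 3"
  assumes f: "f \<in> cball 0 1"
  obtains u1 u2 :: "complex ^ 2"
  where "cinner u1 u1 + cinner u2 u2 = 2"
    and "\<And>p. cinner (pauli p *v u1) u1 + cinner (pauli p *v u2) u2 = 2 * complex_of_real (f $ p)"
proof -
  define F where "F = (f $ 1)\<^sup>2 + (f $ 2)\<^sup>2 + (f $ 3)\<^sup>2"
  have F: "F \<le> 1"
  proof -
    have "F = (norm f)\<^sup>2"
      by (simp add: F_def norm_vec_def L2_set_def sum_3)
    then show ?thesis
      using f by (simp add: abs_square_le_1)
  qed
  \<comment> \<open>With \<open>g = f / (2 a)\<close> the condition on the norms reads
    \<open>4 a^4 - 4 a^2 + F = 0\<close>. The larger root \<open>a^2\<close> is taken, as the
    smaller one vanishes for \<open>F = 0\<close>.\<close>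
  define a where "a = sqrt ((1 + sqrt (1 - F)) / 2)"
  have a2: "a\<^sup>2 = (1 + sqrt (1 - F)) / 2"
    using F by (simp add: a_def)
  have "a > 0"
    using F by (simp add: a_def add_pos_nonneg)
  have "(2 * a\<^sup>2 - 1)\<^sup>2 = 1 - F"
    using F unfolding a2 by (simp add: field_simps)
  then have quad: "4 * a\<^sup>2 * a\<^sup>2 + F = 4 * a\<^sup>2"
    by (simp add: power2_eq_square algebra_simps)
  define g where "g k = f $ k / (2 * a)" for k
  have fg: "f $ k = 2 * a * g k" for k
    using \<open>a > 0\<close> by (simp add: g_def)
  have "4 * a\<^sup>2 * (a\<^sup>2 + (g 1)\<^sup>2 + (g 2)\<^sup>2 + (g 3)\<^sup>2) = 4 * a\<^sup>2"
    using quad unfolding F_def fg by (simp add: power_mult_distrib algebra_simps)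
  then have norm1: "a * a + g 1 * g 1 + g 2 * g 2 + g 3 * g 3 = 1"
    using \<open>a > 0\<close> by (simp add: power2_eq_square)
  define u1 u2 :: "complex ^ 2" where "u1 = vector [Complex (a + g 3) 0, Complex (g 1) (g 2)]"
    and "u2 = vector [Complex (g 1) (- g 2), Complex (a - g 3) 0]"
  show ?thesis
  proof
    show "cinner u1 u1 + cinner u2 u2 = 2"
      using norm1
      by (simp add: cinner_def sum_2 u1_def u2_def complex_eq_iff algebra_simps)
    show "cinner (pauli p *v u1) u1 + cinner (pauli p *v u2) u2 = 2 * complex_of_real (f $ p)" for p
      using exhaust_3[of p]
      by (auto simp: cinner_def sum_2 u1_def u2_def complex_eq_iff fg matrix_vector_mult_def algebra_simps)
  qed
qed

text \<open>The form is tested at u1 \<otimes> v and u2 \<otimes> v and the values are added: the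
  first factor then contributes 2 for the identity and \<open>2 * f $ p\<close> for
  \<open>pauli p\<close>. Two vectors are taken because f inside the ball describes a mixed
  state.\<close>

lemma psd_kron_pauli:
  fixes Q0 :: cmat2 and Q :: "3 \<Rightarrow> cmat2"
  assumes psd: "psd (kron (mat 1) Q0 + (\<Sum>p\<in>UNIV. kron (pauli p) (Q p)))"
    and f: "f \<in> cball (0 :: real ^ 3) 1"
  shows "psd (Q0 + (\<Sum>p\<in>UNIV. mscale (complex_of_real (f $ p)) (Q p)))"
  unfolding psd_def
proof
  fix v
  obtain u1 u2 :: "complex ^ 2" where u:
    "cinner u1 u1 + cinner u2 u2 = 2"
    "\<And>p. cinner (pauli p *v u1) u1 + cinner (pauli p *v u2) u2 = 2 * complex_of_real (f $ p)"
    using qubit_state_decomposition[OF f] by blast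
  let ?S = "\<lambda>u. cinner u u * cinner (Q0 *v v) v +
    (\<Sum>p\<in>UNIV. cinner (pauli p *v u) u * cinner (Q p *v v) v)"
  have S: "0 \<le> ?S u" for u
    using psd[unfolded psd_def, rule_format, of "\<chi> p. u $ fst p * v $ snd p"]
    by (simp add: matrix_vector_mult_add_rdistrib sum_matrix_vector_mult cinner_add_left
        cinner_sum_left cinner_kron)
  have "?S u1 + ?S u2 = (cinner u1 u1 + cinner u2 u2) * cinner (Q0 *v v) v +
    (\<Sum>p\<in>UNIV. (cinner (pauli p *v u1) u1 + cinner (pauli p *v u2) u2) * cinner (Q p *v v) v)"
    by (simp add: algebra_simps sum.distrib)
  also have "\<dots> = 2 * cinner ((Q0 + (\<Sum>p\<in>UNIV. mscale (complex_of_real (f $ p)) (Q p))) *v v) v"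
    by (simp add: u matrix_vector_mult_add_rdistrib sum_matrix_vector_mult cinner_add_left
        cinner_sum_left mscale_matrix_vector_mult cinner_scale_left algebra_simps sum_distrib_left)
  finally show "0 \<le> cinner ((Q0 + (\<Sum>p\<in>UNIV. mscale (complex_of_real (f $ p)) (Q p))) *v v) v"
    using add_nonneg_nonneg[OF S[of u1] S[of u2]] by (auto simp: less_eq_complex_def)
qed

text \<open>The determinant \<open>s^2 - (norm c)^2\<close> of a positive matrix is nonnegative,
  once positivity has shown \<open>s\<close> and \<open>c\<close> to be real.\<close>

lemma psd_pauli:
  assumes "psd (mscale s (mat 1) + pauli_vec c)"
  shows "complex_of_real (norm c) \<le> s"
proof -
  have P: "0 \<le> ((s + c $ 3) * x + (c $ 1 - \<i> * c $ 2) * y) * cnj x +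
      ((c $ 1 + \<i> * c $ 2) * x + (s - c $ 3) * y) * cnj y" for x y
    using assms[unfolded psd_def, rule_format, of "vector [x, y]"]
    by (simp add: cinner_def matrix_vector_mult_def sum_2 sum_3 mscale_def mat_def pauli_vec_def
        algebra_simps)
  have re: "Im s = 0" "0 \<le> Re s" "\<And>k. Im (c $ k) = 0" and bd: "\<And>k. \<bar>Re (c $ k)\<bar> \<le> Re s"
  proof -
    have "Im s = 0 \<and> 0 \<le> Re s \<and> Im (c $ k) = 0 \<and> \<bar>Re (c $ k)\<bar> \<le> Re s" for k
      \<comment> \<open>The test vectors are eigenvectors of the three Pauli matrices, so the values
        are positive multiples of \<open>s + c $ k\<close> and \<open>s - c $ k\<close>.\<close>
      using exhaust_3[of k] P[of 1 0] P[of 0 1] P[of 1 1] P[of 1 "-1"] P[of 1 \<i>] P[of 1 "-\<i>"]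
      by (auto simp: less_eq_complex_def)
    then show "Im s = 0" "0 \<le> Re s" "\<And>k. Im (c $ k) = 0" "\<And>k. \<bar>Re (c $ k)\<bar> \<le> Re s"
      by auto
  qed
  define t a where "t = Re s" and "a k = Re (c $ k)" for k
  have s: "s = complex_of_real t" and c: "\<And>k. c $ k = complex_of_real (a k)"
    using re by (simp_all add: complex_eq_iff t_def a_def)
  define d where "d = t\<^sup>2 - ((a 1)\<^sup>2 + (a 2)\<^sup>2 + (a 3)\<^sup>2)"
  \<comment> \<open>\<open>d\<close> is the determinant; the columns of the adjugate are mapped to its multiples of the unit vectors.\<close>
  have "0 \<le> (t + a 3) * d"
    using P[of "- Complex (a 1) (- a 2)" "Complex (t + a 3) 0"] unfolding s c
    by (simp add: less_eq_complex_def d_def power2_eq_square algebra_simps)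
  moreover have "0 \<le> (t - a 3) * d"
    using P[of "Complex (t - a 3) 0" "- Complex (a 1) (a 2)"] unfolding s c
    by (simp add: less_eq_complex_def d_def power2_eq_square algebra_simps)
  ultimately have td: "0 \<le> t * d"
    by (simp add: algebra_simps)
  have "0 \<le> d"
  proof (cases "t = 0")
    case True
    then have "a k = 0" for k
      using bd[of k] by (simp add: t_def a_def)
    then show ?thesis
      using True by (simp add: d_def)
  next
    case False
    then show ?thesis
      using td re(2) by (simp add: t_def zero_le_mult_iff)
  qed
  then have "sqrt ((a 1)\<^sup>2 + (a 2)\<^sup>2 + (a 3)\<^sup>2) \<le> t"
    using re(2) by (intro real_le_lsqrt) (auto simp: d_def t_def)
  moreover have "norm c = sqrt ((a 1)\<^sup>2 + (a 2)\<^sup>2 + (a 3)\<^sup>2)"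
    by (simp add: norm_vec_def L2_set_def sum_3 c)
  ultimately show ?thesis
    by (simp add: s less_eq_complex_def)
qed

section \<open>Real coefficients of the map\<close>

lemma kadison_schwarz_hermitian:
  assumes lin: "clinear_map D" and one: "unital_map D" and ks: "kadison_schwarz D"
    and herm: "adjoint_mat A = A" and A: "A ** A = mat 1"
  shows "adjoint_mat (D A) = D A"
proof -
  interpret Vector_Spaces.linear mscale mscale D
    using lin by (simp add: clinear_map_def)
  \<comment> \<open>Adding the positive matrix \<open>adjoint_mat (D x) ** D x\<close> to the
    Kadison-Schwarz difference leaves positivity of the map on squares.\<close>
  have "psd (D (adjoint_mat x ** x))" for x :: cmat2
  proof -
    have "psd (D (adjoint_mat x ** x) - adjoint_mat (D x) ** D x)"
      using ks by (simp add: kadison_schwarz_def loewner_le_def)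
    from psd_add[OF this psd_adjoint_mult[of "D x"]] show ?thesis
      by simp
  qed
  moreover have "adjoint_mat (mat 1 + A) = mat 1 + A"
    using herm by (auto simp: adjoint_mat_def vec_eq_iff mat_def)
  moreover have "(mat 1 + A) ** (mat 1 + A) = mscale 2 (mat 1) + mscale 2 A"
    by (simp add: matrix_add_ldistrib matrix_add_rdistrib A)
       (simp add: mscale_def vec_eq_iff)
  ultimately have "psd (D (mscale 2 (mat 1) + mscale 2 A))"
    by metis
  then have "adjoint_mat (mscale 2 (mat 1) + mscale 2 (D A)) = mscale 2 (mat 1) + mscale 2 (D A)"
    using one psd_hermitian by (simp add: add scale unital_map_def kron_one)
  then show ?thesis
    by (auto simp: adjoint_mat_def vec_eq_iff mscale_def mat_def split: if_splits)
qed

lemma pauli_vec_add: "pauli_vec (u + v) = pauli_vec u + pauli_vec v"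
  by (simp add: pauli_vec_def mscale_def vec_eq_iff algebra_simps sum.distrib)

lemma pauli_vec_scale: "pauli_vec (c *s u) = mscale c (pauli_vec u)"
  by (simp add: pauli_vec_def mscale_def vec_eq_iff mult_ac sum_distrib_left)

lemma kron_pauli_vec:
  "(\<Sum>l\<in>UNIV. mscale (u $ l) (kron A (pauli l))) = kron A (pauli_vec u)"
  by (simp add: kron_def pauli_vec_def mscale_def vec_eq_iff mult_ac sum_distrib_left)

lemma pauli_vec_mult_cnj:
  "pauli_vec u ** pauli_vec (cnj_vec v) =
     mscale (cinner u v) (mat 1) + pauli_vec (\<i> *s ccross u (cnj_vec v))"
  by (simp add: pauli_vec_mult cinner_def cnj_vec_def)

lemma pauli_vec_mult_cnj_self:
  "pauli_vec u ** pauli_vec (cnj_vec u) =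
     mscale (complex_of_real ((norm u)\<^sup>2)) (mat 1) + pauli_vec (\<i> *s ccross u (cnj_vec u))"
  by (simp only: pauli_vec_mult_cnj cinner_self)

text \<open>Antisymmetry of the cross product turns the difference of the two products into the sum
  that defines \<open>gamma_vec\<close>; the scalar part becomes \<open>alpha\<close>, up to the
  factor \<open>\<i>\<close>.\<close>

lemma pauli_vec_cross_terms:
  "mscale \<i> (pauli_vec u ** pauli_vec (cnj_vec v) - pauli_vec v ** pauli_vec (cnj_vec u)) =
     mscale (\<i> * (cinner u v - cinner v u)) (mat 1)
     - pauli_vec (ccross u (cnj_vec v) + ccross (cnj_vec u) v)"
proof -
  have "ccross (cnj_vec u) v = - ccross v (cnj_vec u)"
    by (simp add: vec_eq_iff ccross_def forall_3 mult.commute)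
  then show ?thesis
    by (simp add: pauli_vec_mult_cnj pauli_vec_scale pauli_vec_add)
       (simp add: vec_eq_iff mscale_def pauli_vec_def algebra_simps sum_subtractf sum_negf)
qed

lemma cinner_cvec_cnj_vec: "cinner (cvec u) (cnj_vec w) = cnj (cinner (cvec u) w)"
  by (simp add: cinner_def cvec_def cnj_vec_def)

text \<open>Each Pauli matrix has trace zero, so the Haar property makes both slices of its image
  vanish and the Pauli expansion applies; linearity does the rest.\<close>

lemma pauli_coefficients:
  assumes lin: "clinear_map D" and one: "unital_map D" and ks: "kadison_schwarz D"
    and haar: "haar_state ntrace D"
  obtains b :: "real ^ 3 ^ 3 ^ 3"
  where "\<And>w. D (pauli_vec w) = (\<Sum>m\<in>UNIV. \<Sum>l\<in>UNIV.
    mscale (cinner (cvec (b $ m $ l)) (cnj_vec w)) (kron (pauli m) (pauli l)))"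
proof -
  interpret Vector_Spaces.linear mscale mscale D
    using lin by (simp add: clinear_map_def)
  have "\<exists>c :: real ^ 3 ^ 3. D (pauli k) =
    (\<Sum>m\<in>UNIV. \<Sum>l\<in>UNIV. mscale (complex_of_real (c $ m $ l)) (kron (pauli m) (pauli l)))" for k
  proof -
    have "ntrace (pauli k) = 0"
      by (simp add: ntrace_def trace_pauli)
    then have "slice_left ntrace (D (pauli k)) = 0" "slice_right ntrace (D (pauli k)) = 0"
      using haar by (simp_all add: haar_state_def mscale_def vec_eq_iff)
    with hermitian_pauli_expansion[OF
        kadison_schwarz_hermitian[OF lin one ks pauli_hermitian pauli_mult(1)]]
    show ?thesis
      by blast
  qed
  then obtain c :: "3 \<Rightarrow> real ^ 3 ^ 3" where c: "\<And>k. D (pauli k) =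
    (\<Sum>m\<in>UNIV. \<Sum>l\<in>UNIV. mscale (complex_of_real (c k $ m $ l)) (kron (pauli m) (pauli l)))"
    using choice[OF allI, of "\<lambda>k c. D (pauli k) =
      (\<Sum>m\<in>UNIV. \<Sum>l\<in>UNIV. mscale (complex_of_real (c $ m $ l)) (kron (pauli m) (pauli l)))"]
    by blast
  show ?thesis
  proof
    fix w
    have "D (pauli_vec w) = (\<Sum>k\<in>UNIV. mscale (w $ k) (D (pauli k)))"
      by (simp add: pauli_vec_def sum scale)
    \<comment> \<open>The index \<open>k\<close> of the argument comes first in \<open>c\<close> and
      last in \<open>b\<close>; the conjugation in \<open>cinner\<close> cancels
      \<open>cnj_vec\<close>.\<close>
    also have "\<dots> = (\<Sum>m\<in>UNIV. \<Sum>l\<in>UNIV.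
      mscale (cinner (cvec ((\<chi> m l k. c k $ m $ l) $ m $ l)) (cnj_vec w)) (kron (pauli m) (pauli l)))"
      by (simp add: c vec_eq_iff mscale_def cinner_def cvec_def cnj_vec_def sum_3 algebra_simps)
    finally show "D (pauli_vec w) = (\<Sum>m\<in>UNIV. \<Sum>l\<in>UNIV.
      mscale (cinner (cvec ((\<chi> m l k. c k $ m $ l) $ m $ l)) (cnj_vec w)) (kron (pauli m) (pauli l)))" .
  qed
qed

section \<open>The two inequalities\<close>

lemma norm_smult_complex: "norm (c *s v) = cmod c * norm (v :: complex ^ 'n)"
  by (simp add: norm_vec_def L2_set_def norm_mult power_mult_distrib real_sqrt_mult
      flip: sum_distrib_left)

theorem theorem3p6:
  fixes \<Delta> :: "complex ^ 2 ^ 2 \<Rightarrow> complex ^ (2 \<times> 2) ^ (2 \<times> 2)"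
  assumes "clinear_map \<Delta>"
    and "unital_map \<Delta>"
    and "kadison_schwarz \<Delta>"
    and "haar_state ntrace \<Delta>"
  shows "\<exists>b :: real ^ 3 ^ 3 ^ 3.
    (\<forall>w0 w. \<Delta> (mscale w0 (mat 1) + pauli_vec w) =
       mscale w0 (kron (mat 1) (mat 1)) +
       (\<Sum>m\<in>UNIV. \<Sum>l\<in>UNIV.
          mscale (cinner (cvec (b $ m $ l)) (cnj_vec w)) (kron (pauli m) (pauli l)))) \<and>
    (\<forall>f\<in>cball (0 :: real ^ 3) 1. \<forall>w :: complex ^ 3.
       0 \<le> complex_of_real ((norm w)\<^sup>2)
           - \<i> * (\<Sum>m = 1..3. complex_of_real (f $ of_nat m) * alpha b w (pi_idx m) (pi_idx (m + 1)))
           - complex_of_real (\<Sum>m\<in>UNIV. (norm (x_vec b w m))\<^sup>2) \<and>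
       complex_of_real (norm (q_vec b f w
           - \<i> *s (\<Sum>m = 1..3. complex_of_real (f $ of_nat m) *s gamma_vec b w (pi_idx m) (pi_idx (m + 1)))
           - (\<Sum>m\<in>UNIV. ccross (x_vec b w m) (cnj_vec (x_vec b w m)))))
         \<le> complex_of_real ((norm w)\<^sup>2)
           - \<i> * (\<Sum>k = 1..3. complex_of_real (f $ of_nat k) * alpha b w (pi_idx k) (pi_idx (k + 1)))
           - complex_of_real (\<Sum>m\<in>UNIV. (norm (x_vec b w m))\<^sup>2))"
proof -
  interpret Vector_Spaces.linear mscale mscale \<Delta>
    using assms(1) by (simp add: clinear_map_def)
  obtain b :: "real ^ 3 ^ 3 ^ 3" where
    b: "\<And>w. \<Delta> (pauli_vec w) = (\<Sum>m\<in>UNIV. \<Sum>l\<in>UNIV.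
      mscale (cinner (cvec (b $ m $ l)) (cnj_vec w)) (kron (pauli m) (pauli l)))"
    using pauli_coefficients[OF assms] by blast
  have expansion: "\<Delta> (mscale w0 (mat 1) + pauli_vec w) =
      mscale w0 (kron (mat 1) (mat 1)) + (\<Sum>m\<in>UNIV. \<Sum>l\<in>UNIV.
        mscale (cinner (cvec (b $ m $ l)) (cnj_vec w)) (kron (pauli m) (pauli l)))" for w0 w
    using assms(2) by (simp add: add scale b unital_map_def)
  \<comment> \<open>Since \<open>b\<close> is real, the coefficients at \<open>pauli m\<close> are
    the conjugates of the entries of \<open>x_vec b w m\<close>.\<close>
  have D_pauli_vec: "\<Delta> (pauli_vec w) = (\<Sum>m\<in>UNIV. kron (pauli m) (pauli_vec (cnj_vec (x_vec b w m))))" for w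
    by (simp add: b x_vec_def cnj_vec_def[of "vec_lambda _"] cinner_cvec_cnj_vec flip: kron_pauli_vec)
  have bound: "complex_of_real (norm (q_vec b f w
           - \<i> *s (\<Sum>m = 1..3. complex_of_real (f $ of_nat m) *s gamma_vec b w (pi_idx m) (pi_idx (m + 1)))
           - (\<Sum>m\<in>UNIV. ccross (x_vec b w m) (cnj_vec (x_vec b w m)))))
         \<le> complex_of_real ((norm w)\<^sup>2)
           - \<i> * (\<Sum>k = 1..3. complex_of_real (f $ of_nat k) * alpha b w (pi_idx k) (pi_idx (k + 1)))
           - complex_of_real (\<Sum>m\<in>UNIV. (norm (x_vec b w m))\<^sup>2)"
    (is "complex_of_real (norm ?V) \<le> ?s")
    if f: "f \<in> cball 0 1" for f :: "real ^ 3" and w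
  proof -
    define x where "x = x_vec b w"
    \<comment> \<open>\<open>z\<close> is the Pauli vector part of
      \<open>adjoint_mat (pauli_vec w) ** pauli_vec w\<close>.\<close>
    define z where "z = \<i> *s ccross (cnj_vec w) w"
    \<comment> \<open>\<open>\<pi> p = (m, n)\<close> means \<open>\<sigma>\<^sub>m \<sigma>\<^sub>n = i \<sigma>\<^sub>p\<close>.\<close>
    define \<pi> :: "3 \<Rightarrow> 3 \<times> 3" where "\<pi> p = (if p = 1 then (2, 3) else if p = 2 then (3, 1) else (1, 2))" for p
    \<comment> \<open>\<open>Q0\<close> and \<open>Q p\<close> are the second factors belonging to
      \<open>mat 1\<close> and \<open>pauli p\<close> in the Kadison-Schwarz difference.\<close>
    define Q0 where "Q0 = mscale (complex_of_real ((norm w)\<^sup>2)) (mat 1)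
      - (\<Sum>m\<in>UNIV. pauli_vec (x m) ** pauli_vec (cnj_vec (x m)))"
    define Q where "Q p = pauli_vec (cnj_vec (x_vec b z p)) - mscale \<i>
      (pauli_vec (x (fst (\<pi> p))) ** pauli_vec (cnj_vec (x (snd (\<pi> p))))
       - pauli_vec (x (snd (\<pi> p))) ** pauli_vec (cnj_vec (x (fst (\<pi> p)))))" for p
    have adj: "adjoint_mat (\<Delta> (pauli_vec w)) = (\<Sum>m\<in>UNIV. kron (pauli m) (pauli_vec (x m)))"
    proof -
      have "adjoint_mat (\<Delta> (pauli_vec w)) =
          (\<Sum>m\<in>UNIV. adjoint_mat (kron (pauli m) (pauli_vec (cnj_vec (x m)))))"
        by (simp add: D_pauli_vec x_def adjoint_mat_def vec_eq_iff)
      also have "\<dots> = (\<Sum>m\<in>UNIV. kron (pauli m) (pauli_vec (x m)))"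
        by (simp add: adjoint_kron pauli_hermitian adjoint_pauli_vec) (simp add: cnj_vec_def)
      finally show ?thesis .
    qed
    have square: "\<Delta> (adjoint_mat (pauli_vec w) ** pauli_vec w) =
        mscale (complex_of_real ((norm w)\<^sup>2)) (kron (mat 1) (mat 1))
        + (\<Sum>m\<in>UNIV. kron (pauli m) (pauli_vec (cnj_vec (x_vec b z m))))"
      unfolding adjoint_pauli_vec_mult z_def[symmetric] using assms(2)
      by (simp only: add scale D_pauli_vec unital_map_def)
    have "psd (\<Delta> (adjoint_mat (pauli_vec w) ** pauli_vec w)
        - adjoint_mat (\<Delta> (pauli_vec w)) ** \<Delta> (pauli_vec w))"
      using assms(3) by (simp add: kadison_schwarz_def loewner_le_def)
    also have "\<Delta> (adjoint_mat (pauli_vec w) ** pauli_vec w)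
        - adjoint_mat (\<Delta> (pauli_vec w)) ** \<Delta> (pauli_vec w) =
        kron (mat 1) Q0 + (\<Sum>p\<in>UNIV. kron (pauli p) (Q p))"
      unfolding adj square unfolding D_pauli_vec x_def[symmetric] pauli_kron_sum_mult
      by (simp add: Q0_def Q_def \<pi>_def sum_3)
         (simp add: kron_def vec_eq_iff mscale_def algebra_simps)
    finally have "psd (Q0 + (\<Sum>p\<in>UNIV. mscale (complex_of_real (f $ p)) (Q p)))"
      using psd_kron_pauli f by blast
    also have "Q0 + (\<Sum>p\<in>UNIV. mscale (complex_of_real (f $ p)) (Q p)) = mscale ?s (mat 1) + pauli_vec (\<i> *s ?V)"
    proof -
      have Q: "Q p = mscale (- \<i> * alpha b w (fst (\<pi> p)) (snd (\<pi> p))) (mat 1) +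
        pauli_vec (cnj_vec (x_vec b z p) + gamma_vec b w (fst (\<pi> p)) (snd (\<pi> p)))" for p
        unfolding Q_def pauli_vec_cross_terms alpha_def gamma_vec_def x_def pauli_vec_add
        by (simp add: vec_eq_iff mscale_def)
      have Q0: "Q0 = mscale (complex_of_real ((norm w)\<^sup>2)
          - complex_of_real (\<Sum>m\<in>UNIV. (norm (x_vec b w m))\<^sup>2)) (mat 1)
        + pauli_vec (- \<i> *s (\<Sum>m\<in>UNIV. ccross (x_vec b w m) (cnj_vec (x_vec b w m))))"
        unfolding Q0_def pauli_vec_mult_cnj_self x_def sum_3 pauli_vec_add pauli_vec_scale
        by (simp add: vec_eq_iff mscale_def algebra_simps)
      \<comment> \<open>Conjugation in the second slot of \<open>cinner\<close> turns [w, cnj w]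
        into [cnj w, w], which times \<open>\<i>\<close> is \<open>z\<close>; summing
        \<open>b\<close> against \<open>f\<close> over its first index gives
        \<open>beta\<close>.\<close>
      have q: "\<i> *s q_vec b f w = (\<Sum>p\<in>UNIV. complex_of_real (f $ p) *s cnj_vec (x_vec b z p))"
        by (simp add: vec_eq_iff forall_3 q_vec_def beta_def cinner_def cvec_def sum_3 cnj_vec_def
            x_vec_def z_def ccross_def algebra_simps)
      \<comment> \<open>For \<open>m\<close> = 1, 2, 3 the pairs
        \<open>(pi_idx m, pi_idx (m + 1))\<close> are (2,3), (3,1), (1,2), the last through
        \<open>pi_idx 4 = 2\<close>; these are the values of the local \<open>\<pi>\<close>.\<close>
      have "\<i> *s ?V = \<i> *s q_vec b f w + (\<Sum>p\<in>UNIV. complex_of_real (f $ p) *s gamma_vec b w (fst (\<pi> p)) (snd (\<pi> p)))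
        - \<i> *s (\<Sum>m\<in>UNIV. ccross (x_vec b w m) (cnj_vec (x_vec b w m)))"
        by (simp add: vec_eq_iff \<pi>_def pi_idx_def sum_3 numeral_3_eq_3 algebra_simps)
      also have "\<dots> = - \<i> *s (\<Sum>m\<in>UNIV. ccross (x_vec b w m) (cnj_vec (x_vec b w m))) +
        (\<Sum>p\<in>UNIV. complex_of_real (f $ p) *s (cnj_vec (x_vec b z p) + gamma_vec b w (fst (\<pi> p)) (snd (\<pi> p))))"
        unfolding q by (simp add: vec_eq_iff sum.distrib algebra_simps)
      finally have V: "\<i> *s ?V = \<dots>" .
      have s: "?s = complex_of_real ((norm w)\<^sup>2) - complex_of_real (\<Sum>m\<in>UNIV. (norm (x_vec b w m))\<^sup>2)
        + (\<Sum>p\<in>UNIV. complex_of_real (f $ p) * (- \<i> * alpha b w (fst (\<pi> p)) (snd (\<pi> p))))"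
        by (simp add: \<pi>_def pi_idx_def sum_3 numeral_3_eq_3 algebra_simps)
      show ?thesis
        unfolding Q Q0 V s unfolding pauli_vec_add sum_3 pauli_vec_scale
        by (simp add: vec_eq_iff mscale_def algebra_simps)
    qed
    finally have "complex_of_real (norm (\<i> *s ?V)) \<le> ?s"
      by (rule psd_pauli)
    moreover have "norm (\<i> *s ?V) = norm ?V"
      by (simp only: norm_smult_complex) simp
    ultimately show ?thesis
      by simp
  qed
  \<comment> \<open>The first inequality follows from the second, as a norm is nonnegative.\<close>
  have "0 \<le> s" if "complex_of_real (norm v) \<le> s" for v :: "complex ^ 3" and s
    using order_trans[of 0, OF _ that] by (simp add: less_eq_complex_def)
  with bound expansion show ?thesis
    by blast
qed

end
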